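(* Let $\mathcal{A}=(a_{i_1i_2\cdots i_m})$ be an order $m$ dimension $n$ nonnegative tensor which is weakly irreducible. For $i=1,\ldots,n$ let $K_i=\sum_{i_2,\ldots,i_m=1}^n a_{ii_2\cdots i_m}$. Then \[ \min_{\gamma \in C(G_{\mathcal{A}})}\Big(\prod_{i\in \gamma} K_i\Big)^{\frac{1}{|\gamma|}}\leqslant \rho(\mathcal{A}) \leqslant \max_{\gamma \in C(G_{\mathcal{A}})} \Big(\prod_{i\in \gamma} K_i\Big)^{\frac{1}{|\gamma|}}. \]
   Context: For a complex order $m$ dimension $n$ tensor $\mathcal{A}$, and $x\in\mathbb{C}^n$, $\mathcal{A}x^{m-1}$ is the vector with $(\mathcal{A}x^{m-1})_i=\sum_{i_2,\ldots,i_m=1}^n a_{ii_2\cdots i_m}x_{i_2}\cdots x_{i_m}$. A complex number $\lambda$ is an eigenvalue of $\mathcal{A}$ if there is a nonzero $x\in\mathbb{C}^n$ with $\mathcal{A}x^{m-1}=\lambda x^{[m-1]}$, where $x^{[m-1]}=(x_1^{m-1},\ldots,x_n^{m-1})^{\mathrm T}$; $\rho(\mathcal{A})$ is the maximum modulus of the eigenvalues of $\mathcal{A}$. The digraph $G_{\mathcal{A}}$ has vertex set $\{1,\ldots,n\}$ and arc set $\{(i,j): a_{ii_2\cdots i_m}\neq 0 \text{ for some } i_2,\ldots,i_m \text{ with } j\in\{i_2,\ldots,i_m\}\}$ (loops $(i,i)$ may occur). $\mathcal{A}$ is weakly irreducible if $G_{\mathcal{A}}$ is strongly connected. $C(G_{\mathcal{A}})$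 is the set of circuits of $G_{\mathcal{A}}$, i.e. directed closed paths $i_1\to i_2\to\cdots\to i_p\to i_{p+1}=i_1$ with $i_1,\ldots,i_p$ distinct (loops, $p=1$, allowed); for such $\gamma$, $|\gamma|=p$ is its length and $\prod_{i\in\gamma}$ is the product over the vertices $i_1,\ldots,i_p$. *)

theory Defs
  imports "Graph_Theory.Digraph_Component" "HOL-Analysis.Analysis"
begin

text \<open>
  An order \<open>m\<close> tensor of dimension \<open>n = CARD('n)\<close> is a function \<open>A\<close> on index lists, with
  \<open>A [i\<^sub>1, \<dots>, i\<^sub>m]\<close> the entry \<open>a\<close> at \<open>i\<^sub>1 \<dots> i\<^sub>m\<close>. Only lists of length \<open>m\<close> matter: no definition below
  looks at the values of \<open>A\<close> on other lists.
\<close>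

definition tuples :: "nat \<Rightarrow> 'n list set" where
  "tuples k = {js. length js = k}"

definition tensor_apply :: "nat \<Rightarrow> ('n::finite list \<Rightarrow> complex) \<Rightarrow> complex ^ 'n \<Rightarrow> complex ^ 'n" where
  "tensor_apply m A x = (\<chi> i. \<Sum>js\<in>tuples (m - 1). A (i # js) * (\<Prod>j\<leftarrow>js. x $ j))"

definition tensor_eigenvalue :: "nat \<Rightarrow> ('n::finite list \<Rightarrow> complex) \<Rightarrow> complex \<Rightarrow> bool" where
  "tensor_eigenvalue m A l \<longleftrightarrow>
     (\<exists>x. x \<noteq> 0 \<and> tensor_apply m A x = (\<chi> i. l * (x $ i) ^ (m - 1)))"

text \<open>
  \<open>GREATEST\<close> rather than \<open>Max\<close>, because \<open>Max\<close> is only specified for sets already known to be finite.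
\<close>

definition tensor_spectral_radius :: "nat \<Rightarrow> ('n::finite list \<Rightarrow> complex) \<Rightarrow> real" where
  "tensor_spectral_radius m A = (GREATEST r. \<exists>l. tensor_eigenvalue m A l \<and> r = cmod l)"

definition tensor_digraph :: "nat \<Rightarrow> ('n list \<Rightarrow> 'a::zero) \<Rightarrow> ('n, 'n \<times> 'n) pre_digraph" where
  "tensor_digraph m A = with_proj
     \<lparr> pverts = UNIV,
       parcs = {(i, j). \<exists>js\<in>tuples (m - 1). A (i # js) \<noteq> 0 \<and> j \<in> set js} \<rparr>"

definition weakly_irreducible :: "nat \<Rightarrow> ('n list \<Rightarrow> 'a::zero) \<Rightarrow> bool" where
  "weakly_irreducible m A \<longleftrightarrow> strongly_connected (tensor_digraph m A)"

text \<open>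
  A circuit \<open>i\<^sub>1 \<rightarrow> \<dots> \<rightarrow> i\<^sub>p \<rightarrow> i\<^sub>1\<close> is the list of its arcs \<open>[(i\<^sub>1, i\<^sub>2), \<dots>, (i\<^sub>p, i\<^sub>1)]\<close>. Hence its length
  is \<open>length\<close>, and its vertices are the first components of its arcs, each occurring once.
  The library's \<open>cycle\<close> admits loops (\<open>p = 1\<close>) and excludes the empty walk. A circuit occurs once
  for each choice of the starting vertex, which does not change the product of its vertex weights.
\<close>

definition circuits :: "('n, 'n \<times> 'n) pre_digraph \<Rightarrow> ('n \<times> 'n) list set" where
  "circuits G = {\<gamma>. pre_digraph.cycle G \<gamma>}"

definition circuit_mean :: "('n \<Rightarrow> real) \<Rightarrow> ('n \<times> 'n) list \<Rightarrow> real" where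
  "circuit_mean K \<gamma> = (\<Prod>e\<leftarrow>\<gamma>. K (fst e)) powr (1 / real (length \<gamma>))"

definition slice_sum :: "nat \<Rightarrow> ('n::finite list \<Rightarrow> real) \<Rightarrow> 'n \<Rightarrow> real" where
  "slice_sum m A i = (\<Sum>js\<in>tuples (m - 1). A (i # js))"

end

theory Submission
  imports Defs
begin

text \<open>
  The spectral radius \<open>l\<close> has a positive eigenvector \<open>x\<close>. If \<open>x\<close> attains its maximum over the
  out-neighbours of \<open>i\<close> at \<open>f i\<close>, the eigenvalue equation gives \<open>l x\<^sub>i\<^sup>m\<^sup>-\<^sup>1 \<le> K\<^sub>i x\<^bsub>f i\<^esub>\<^sup>m\<^sup>-\<^sup>1\<close>. Following \<open>f\<close>
  leads into a circuit, around which the powers of \<open>x\<close> cancel, so that \<open>l\<close> is at most the geometric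
  mean of the \<open>K\<^sub>i\<close> on that circuit. The lower bound is symmetric, with minima instead of maxima.

  For the eigenvector, Brouwer's theorem on the simplex solves the problem with \<open>e > 0\<close> added to
  every component of the form. Strong connectivity bounds the ratios of the components of the
  solutions independently of \<open>e\<close>, so a limit point for \<open>e \<rightarrow> 0\<close> is still positive.
\<close>

text \<open>Keeps \<open>m - 1\<close> from being rewritten to \<open>m - Suc 0\<close>, so that
  facts about this exponent still match.\<close>

declare One_nat_def [simp del]

section \<open>Index tuples and products over lists\<close>

lemma finite_tuples [simp]: "finite (tuples k :: 'n::finite list set)"
  using finite_lists_length_eq[of "UNIV :: 'n set" k] by (simp add: tuples_def)

lemma Cons_mem_tuples: "m > 0 \<Longrightarrow> js \<in> tuples (m - 1) \<Longrightarrow> i # js \<in> tuples m"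
  by (auto simp: tuples_def)

lemma prod_list_mono_nonneg:
  fixes f g :: "'a \<Rightarrow> 'b::linordered_idom"
  assumes "\<And>x. x \<in> set xs \<Longrightarrow> 0 \<le> f x" "\<And>x. x \<in> set xs \<Longrightarrow> f x \<le> g x"
  shows "0 \<le> (\<Prod>x\<leftarrow>xs. f x)" "(\<Prod>x\<leftarrow>xs. f x) \<le> (\<Prod>x\<leftarrow>xs. g x)"
proof -
  have "0 \<le> (\<Prod>x\<leftarrow>xs. f x) \<and> (\<Prod>x\<leftarrow>xs. f x) \<le> (\<Prod>x\<leftarrow>xs. g x)"
    using assms
  proof (induction xs)
    case (Cons a xs)
    then have "0 \<le> f a" "f a \<le> g a" "0 \<le> (\<Prod>x\<leftarrow>xs. f x) \<and> (\<Prod>x\<leftarrow>xs. f x) \<le> (\<Prod>x\<leftarrow>xs. g x)"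
      by auto
    then show ?case by (auto intro!: mult_mono)
  qed simp
  then show "0 \<le> (\<Prod>x\<leftarrow>xs. f x)" "(\<Prod>x\<leftarrow>xs. f x) \<le> (\<Prod>x\<leftarrow>xs. g x)" by auto
qed

lemma prod_list_pos:
  fixes f :: "'a \<Rightarrow> 'b::linordered_idom"
  shows "(\<And>x. x \<in> set xs \<Longrightarrow> 0 < f x) \<Longrightarrow> 0 < (\<Prod>x\<leftarrow>xs. f x)"
  by (induction xs) auto

lemma prod_list_map_const: "(\<Prod>x\<leftarrow>xs. c) = (c :: 'a::comm_monoid_mult) ^ length xs"
  by (induction xs) auto

lemma prod_list_map_mult:
  "(\<Prod>x\<leftarrow>xs. f x * g x) = (\<Prod>x\<leftarrow>xs. f x) * (\<Prod>x\<leftarrow>xs. g x :: 'a::comm_monoid_mult)"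
  by (induction xs) (auto simp: ac_simps)

lemma tendsto_prod_list:
  fixes f :: "'a \<Rightarrow> 'b \<Rightarrow> 'c::{real_normed_algebra_1}"
  assumes "\<And>x. x \<in> set xs \<Longrightarrow> (f x \<longlongrightarrow> l x) F"
  shows "((\<lambda>t. \<Prod>x\<leftarrow>xs. f x t) \<longlongrightarrow> (\<Prod>x\<leftarrow>xs. l x)) F"
  using assms by (induction xs) (auto intro!: tendsto_mult)

text \<open>Real counterpart of a component of \<open>tensor_apply\<close>, a form of degree
  \<open>m - 1\<close>. Complex numbers return only when the spectral radius is identified.\<close>

definition slice_form :: "nat \<Rightarrow> ('n::finite list \<Rightarrow> real) \<Rightarrow> real ^ 'n \<Rightarrow> 'n \<Rightarrow> real" where
  "slice_form m A x i = (\<Sum>js\<in>tuples (m - 1). A (i # js) * (\<Prod>j\<leftarrow>js. x $ j))"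

lemma tendsto_slice_form:
  assumes "(f \<longlongrightarrow> x) F"
  shows "((\<lambda>t. slice_form m A (f t) i) \<longlongrightarrow> slice_form m A x i) F"
  unfolding slice_form_def
  by (intro tendsto_sum tendsto_mult tendsto_const tendsto_prod_list tendsto_vec_nth assms)

lemma slice_form_scale: "slice_form m A (c *\<^sub>R x) i = c ^ (m - 1) * slice_form m A x i"
  by (auto simp: slice_form_def sum_distrib_left prod_list_map_mult prod_list_map_const
      tuples_def intro!: sum.cong)

lemma arcs_tensor_digraph:
  "(i, j) \<in> arcs (tensor_digraph m A) \<longleftrightarrow> (\<exists>js\<in>tuples (m - 1). A (i # js) \<noteq> 0 \<and> j \<in> set js)"
  by (simp add: tensor_digraph_def)

lemma tensor_digraph_simps [simp]:
  "verts (tensor_digraph m A) = UNIV" "tail (tensor_digraph m A) = fst"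
  "head (tensor_digraph m A) = snd" "arcs_ends (tensor_digraph m A) = arcs (tensor_digraph m A)"
  by (simp_all add: tensor_digraph_def)

lemma wf_digraph_tensor_digraph: "wf_digraph (tensor_digraph m A)"
  by unfold_locales simp_all

section \<open>Monotonicity of the forms and a Harnack inequality\<close>

locale nonneg_tensor =
  fixes m :: nat and A :: "'n::finite list \<Rightarrow> real"
  assumes order: "m \<ge> 2"
    and nonneg: "\<And>idx. idx \<in> tuples m \<Longrightarrow> A idx \<ge> 0"
begin

abbreviation "E \<equiv> arcs (tensor_digraph m A)"

lemma slice_nonneg: "js \<in> tuples (m - 1) \<Longrightarrow> A (i # js) \<ge> 0"
  using order by (intro nonneg Cons_mem_tuples) auto

lemma slice_sum_nonneg: "slice_sum m A i \<ge> 0"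
  unfolding slice_sum_def by (intro sum_nonneg slice_nonneg)

text \<open>A monomial with nonzero coefficient in slice \<open>i\<close> involves only
  out-neighbours of \<open>i\<close>, so the vectors need comparing only there. Taking
  \<open>y = x\<close>, the first claim gives nonnegativity of the form.\<close>

lemma slice_form_mono:
  assumes "\<And>j. (i, j) \<in> E \<Longrightarrow> 0 \<le> x $ j" "\<And>j. (i, j) \<in> E \<Longrightarrow> x $ j \<le> y $ j"
  shows "0 \<le> slice_form m A x i" "slice_form m A x i \<le> slice_form m A y i"
proof -
  have *: "0 \<le> A (i # js) * (\<Prod>j\<leftarrow>js. x $ j) \<and>
    A (i # js) * (\<Prod>j\<leftarrow>js. x $ j) \<le> A (i # js) * (\<Prod>j\<leftarrow>js. y $ j)"
    if js: "js \<in> tuples (m - 1)" for js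
  proof (cases "A (i # js) = 0")
    case False
    then have "(i, j) \<in> E" if "j \<in> set js" for j
      using js that by (auto simp: arcs_tensor_digraph)
    then have "0 \<le> (\<Prod>j\<leftarrow>js. x $ j)" "(\<Prod>j\<leftarrow>js. x $ j) \<le> (\<Prod>j\<leftarrow>js. y $ j)"
      using assms by (auto intro!: prod_list_mono_nonneg[of js "($) x" "($) y"])
    with slice_nonneg[OF js, of i] show ?thesis
      by (auto intro: mult_left_mono)
  qed simp
  show "0 \<le> slice_form m A x i"
    unfolding slice_form_def using * by (intro sum_nonneg) blast
  show "slice_form m A x i \<le> slice_form m A y i"
    unfolding slice_form_def using * by (intro sum_mono) blast
qed

lemma slice_form_const: "slice_form m A (\<chi> j. c) i = slice_sum m A i * c ^ (m - 1)"
  by (auto simp: slice_form_def slice_sum_def sum_distrib_right prod_list_map_const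
      tuples_def intro!: sum.cong)

text \<open>The arc provides a monomial that contains \<open>x $ j\<close>. Its other
  \<open>m - 2\<close> factors are at least \<open>c\<close>, its coefficient is at least
  \<open>a\<close>, and the remaining monomials are nonnegative.\<close>

lemma slice_form_ge_arc:
  assumes "(i, j) \<in> E" "0 < c" "\<And>k. c \<le> x $ k"
    and a: "\<And>idx. idx \<in> tuples m \<Longrightarrow> A idx \<noteq> 0 \<Longrightarrow> a \<le> A idx"
  shows "a * (x $ j * c ^ (m - 2)) \<le> slice_form m A x i"
proof -
  obtain js where js: "js \<in> tuples (m - 1)" "A (i # js) \<noteq> 0" "j \<in> set js"
    using assms(1) by (auto simp: arcs_tensor_digraph)
  obtain ys zs where split: "js = ys @ j # zs" using split_list[OF js(3)] by blast
  have pos: "0 < x $ k" for k using assms(2) assms(3)[of k] by simp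
  have bound: "c ^ length l \<le> (\<Prod>k\<leftarrow>l. x $ k)" for l
    using prod_list_mono_nonneg(2)[where xs = l and f = "\<lambda>_. c" and g = "($) x"] assms(2,3)
    by (simp add: prod_list_map_const)
  have "length ys + length zs = m - 2" using js(1) split by (simp add: tuples_def)
  then have "x $ j * c ^ (m - 2) = x $ j * (c ^ length (ys @ zs))" by simp
  also have "\<dots> \<le> x $ j * (\<Prod>k\<leftarrow>ys @ zs. x $ k)"
    by (rule mult_left_mono[OF bound]) (use pos[of j] in simp)
  also have "\<dots> = (\<Prod>k\<leftarrow>js. x $ k)" by (simp add: split ac_simps)
  finally have 1: "x $ j * c ^ (m - 2) \<le> (\<Prod>k\<leftarrow>js. x $ k)" .
  have "a * (x $ j * c ^ (m - 2)) \<le> A (i # js) * (\<Prod>k\<leftarrow>js. x $ k)"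
    using 1 a[OF Cons_mem_tuples[OF _ js(1)] js(2)] order pos[of j] assms(2) slice_nonneg[OF js(1)]
    by (intro mult_mono) auto
  also have "\<dots> \<le> slice_form m A x i"
    unfolding slice_form_def using js(1) pos
    by (intro member_le_sum[where f = "\<lambda>js. A (i # js) * (\<Prod>j\<leftarrow>js. x $ j)"])
       (auto intro!: mult_nonneg_nonneg slice_nonneg less_imp_le[OF prod_list_pos])
  finally show ?thesis .
qed

lemma nonzero_entries_bounded_below:
  obtains a where "a > 0" "\<And>idx. idx \<in> tuples m \<Longrightarrow> A idx \<noteq> 0 \<Longrightarrow> a \<le> A idx"
proof
  \<comment> \<open>The inserted 1 keeps the set nonempty when all entries vanish.\<close>
  let ?B = "insert 1 (A ` {idx \<in> tuples m. A idx \<noteq> 0})"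
  show "Min ?B > 0" using nonneg by (subst Min_gr_iff) (auto simp: less_le)
  show "Min ?B \<le> A idx" if "idx \<in> tuples m" "A idx \<noteq> 0" for idx
    using that by (intro Min_le) auto
qed

text \<open>Along an arc \<open>(y, z)\<close> the inequality at \<open>y\<close> bounds \<open>x\<^sub>z\<close> by a multiple of \<open>x\<^sub>u\<close>, as soon as
  \<open>x\<^sub>y\<close> is so bounded, because every other factor of the monomial is at least the minimum \<open>x\<^sub>u\<close>.\<close>

lemma harnack_from_minimum:
  assumes "L \<ge> 0" "u \<rightarrow>\<^sup>*\<^bsub>tensor_digraph m A\<^esub> v"
  shows "\<exists>C>0. \<forall>x. (\<forall>i. 0 < x $ u \<and> x $ u \<le> x $ i \<and> slice_form m A x i \<le> L * (x $ i) ^ (m - 1)) \<longrightarrow>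
    x $ v \<le> C * x $ u"
  using assms(2) unfolding reachable_def
proof (induction rule: rtrancl_on_induct)
  case base
  show ?case by (rule exI[of _ 1]) auto
next
  case (step y z)
  obtain C where C: "C > 0"
    "\<And>x. (\<forall>i. 0 < x $ u \<and> x $ u \<le> x $ i \<and> slice_form m A x i \<le> L * (x $ i) ^ (m - 1)) \<Longrightarrow>
      x $ y \<le> C * x $ u" using step.IH by blast
  obtain a where a: "a > 0" "\<And>idx. idx \<in> tuples m \<Longrightarrow> A idx \<noteq> 0 \<Longrightarrow> a \<le> A idx"
    using nonzero_entries_bounded_below by blast
  \<comment> \<open>The summand 1 makes \<open>D\<close> positive even if
    \<open>L = 0\<close>.\<close>
  define D where "D = (L / a) * C ^ (m - 1) + 1"
  have "x $ z \<le> D * x $ u"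
    if x: "\<forall>i. 0 < x $ u \<and> x $ u \<le> x $ i \<and> slice_form m A x i \<le> L * (x $ i) ^ (m - 1)" for x
  proof -
    have u: "0 < x $ u" "\<And>i. x $ u \<le> x $ i" using x by auto
    have "a * (x $ z * (x $ u) ^ (m - 2)) \<le> slice_form m A x y"
      by (rule slice_form_ge_arc[OF _ u a(2)]) (use step.hyps in auto)
    also have "\<dots> \<le> L * (x $ y) ^ (m - 1)" using x by auto
    also have "\<dots> \<le> L * (C * x $ u) ^ (m - 1)"
      using C(2)[OF x] u(1) u(2)[of y] assms(1) by (intro mult_left_mono power_mono) auto
    also have "\<dots> = L * C ^ (m - 1) * x $ u * (x $ u) ^ (m - 2)"
    proof -
      have "m - 1 = Suc (m - 2)" using order by simp
      then show ?thesis by (simp add: power_mult_distrib)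
    qed
    finally have "a * x $ z \<le> L * C ^ (m - 1) * x $ u" using u(1) by simp
    then have "x $ z \<le> (L / a) * C ^ (m - 1) * x $ u" using a(1) by (simp add: field_simps)
    then show ?thesis using u(1) by (simp add: D_def algebra_simps)
  qed
  moreover have "D > 0" using C(1) a(1) assms(1) by (simp add: D_def add_nonneg_pos)
  ultimately show ?case by blast
qed

end

locale weakly_irreducible_tensor = nonneg_tensor m A
  for m :: nat and A :: "'n::finite list \<Rightarrow> real" +
  assumes wirr: "weakly_irreducible m A"
begin

lemma reach: "u \<rightarrow>\<^sup>*\<^bsub>tensor_digraph m A\<^esub> v"
  using wirr by (auto simp: weakly_irreducible_def strongly_connected_def)

text \<open>Strong connectivity gives a constant from \<open>harnack_from_minimum\<close> for every
  pair of vertices. Their sum bounds each of them, so the constant depends neither on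
  \<open>x\<close> nor on where its minimum lies.\<close>

lemma harnack:
  assumes "L \<ge> 0"
  obtains C where "C > 0"
    "\<And>x i j. (\<And>k. 0 < x $ k) \<Longrightarrow> (\<And>k. slice_form m A x k \<le> L * (x $ k) ^ (m - 1)) \<Longrightarrow>
      x $ i \<le> C * x $ j"
proof -
  obtain C where C: "\<And>u v. C u v > 0"
    "\<And>u v x. (\<And>i. 0 < x $ u \<and> x $ u \<le> x $ i \<and> slice_form m A x i \<le> L * (x $ i) ^ (m - 1)) \<Longrightarrow>
      x $ v \<le> C u v * x $ u"
    using harnack_from_minimum[OF assms reach] by metis
  define D where "D = (\<Sum>u\<in>UNIV. \<Sum>v\<in>UNIV. C u v)"
  have C_le: "C u v \<le> D" for u v
  proof -
    have "C u v \<le> (\<Sum>v\<in>UNIV. C u v)"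
      by (rule member_le_sum) (auto intro: less_imp_le C)
    also have "\<dots> \<le> D"
      unfolding D_def
      by (rule member_le_sum) (auto intro!: sum_nonneg less_imp_le[OF C(1)])
    finally show ?thesis .
  qed
  show thesis
  proof
    show "D > 0" using C(1)[of undefined undefined] C_le[of undefined undefined] by simp
    fix x i j
    assume x: "\<And>k. 0 < x $ k" "\<And>k. slice_form m A x k \<le> L * (x $ k) ^ (m - 1)"
    \<comment> \<open>A vertex where \<open>x\<close> is minimal, as
      \<open>harnack_from_minimum\<close> requires.\<close>
    obtain u where "\<And>k. x $ u \<le> x $ k"
      using Min_le[of "range (($) x)"] Min_in[of "range (($) x)"] by fastforce
    then have "x $ i \<le> C u i * x $ u" using C(2) x by blast
    also have "\<dots> \<le> D * x $ j"
      using C_le[of u i] C(1)[of u i] x(1)[of u] \<open>x $ u \<le> x $ j\<close> by (intro mult_mono) auto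
    finally show "x $ i \<le> D * x $ j" .
  qed
qed

end

section \<open>The perturbed eigenvalue problem on the simplex\<close>

definition prob_simplex :: "(real ^ 'n::finite) set" where
  "prob_simplex = {x. (\<forall>i. 0 \<le> x $ i) \<and> (\<Sum>i\<in>UNIV. x $ i) = 1}"

lemma prob_simplex_le_1: "x \<in> prob_simplex \<Longrightarrow> x $ i \<le> 1"
  using member_le_sum[of i UNIV "($) x"] by (auto simp: prob_simplex_def)

lemma compact_prob_simplex: "compact (prob_simplex :: (real ^ 'n::finite) set)"
proof -
  have "(prob_simplex :: (real ^ 'n) set) = cbox 0 1 \<inter> {x :: real ^ 'n. (\<Sum>i\<in>UNIV. x $ i) = 1}"
    by (auto simp: mem_box_cart prob_simplex_le_1) (auto simp: prob_simplex_def)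
  moreover have "closed {x :: real ^ 'n. (\<Sum>i\<in>UNIV. x $ i) = 1}"
    by (intro closed_Collect_eq continuous_intros)
  ultimately show ?thesis by (metis compact_Int_closed compact_cbox)
qed

lemma convex_prob_simplex: "convex prob_simplex"
  unfolding convex_def prob_simplex_def
  by (auto simp: sum.distrib sum_distrib_left[symmetric])

lemma prob_simplex_nonempty: "prob_simplex \<noteq> ({} :: (real ^ 'n::finite) set)"
proof -
  have "(\<chi> i :: 'n. 1 / real CARD('n)) \<in> prob_simplex" by (simp add: prob_simplex_def)
  then show ?thesis by blast
qed

context nonneg_tensor
begin

text \<open>The root compensates the degree \<open>m - 1\<close>, so that a fixed point up to
  scaling solves the eigenvalue equation with \<open>e\<close> added to the form. A positive
  \<open>e\<close> makes all components positive on the simplex.\<close>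

definition perturbed_root :: "real \<Rightarrow> real ^ 'n \<Rightarrow> real ^ 'n" where
  "perturbed_root e x = (\<chi> i. root (m - 1) (slice_form m A x i + e))"

lemma tendsto_perturbed_root:
  assumes "(f \<longlongrightarrow> x) F" "(g \<longlongrightarrow> e) F"
  shows "((\<lambda>t. perturbed_root (g t) (f t) $ i) \<longlongrightarrow> perturbed_root e x $ i) F"
  unfolding perturbed_root_def vec_lambda_beta
  by (intro tendsto_real_root tendsto_add tendsto_slice_form assms)

text \<open>Dividing the map by the sum of its components, which is positive, gives a continuous
  self-map of the simplex. Its Brouwer fixed point, cleared of the denominator, is the
  solution.\<close>

lemma perturbed_fixpoint:
  assumes "e > 0"
  obtains x where "x \<in> prob_simplex"
    "\<And>i. perturbed_root e x $ i = (\<Sum>j\<in>UNIV. perturbed_root e x $ j) * x $ i"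
    "\<And>i. 0 < perturbed_root e x $ i"
proof -
  have pos: "0 < perturbed_root e x $ i" if "x \<in> prob_simplex" for x i
    using that assms order slice_form_mono(1)[of i x x]
    by (auto simp: perturbed_root_def prob_simplex_def intro!: real_root_gt_zero add_nonneg_pos)
  define s where "s x = (\<Sum>j\<in>UNIV. perturbed_root e x $ j)" for x
  have s_pos: "0 < s x" if "x \<in> prob_simplex" for x
    unfolding s_def using pos[OF that] by (intro sum_pos) auto
  define f where "f x = (\<chi> i. perturbed_root e x $ i / s x)" for x
  have "continuous_on prob_simplex f"
    unfolding continuous_on_def
  proof
    fix x :: "real ^ 'n" assume "x \<in> prob_simplex"
    then have "s x \<noteq> 0" using s_pos[of x] by simp
    then show "(f \<longlongrightarrow> f x) (at x within prob_simplex)"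
      unfolding f_def s_def
      by (intro tendsto_vec_lambda tendsto_divide tendsto_sum tendsto_perturbed_root
          tendsto_ident_at tendsto_const)
  qed
  moreover have "f \<in> prob_simplex \<rightarrow> prob_simplex"
  proof
    fix x :: "real ^ 'n" assume x: "x \<in> prob_simplex"
    have "(\<Sum>i\<in>UNIV. f x $ i) = 1"
      using s_pos[OF x] by (simp add: f_def s_def[of x] flip: sum_divide_distrib)
    then show "f x \<in> prob_simplex"
      using pos[OF x] s_pos[OF x] by (auto simp: prob_simplex_def f_def intro: divide_nonneg_nonneg less_imp_le)
  qed
  ultimately obtain x where x: "x \<in> prob_simplex" "f x = x"
    using brouwer[OF compact_prob_simplex convex_prob_simplex prob_simplex_nonempty] by metis
  have "perturbed_root e x $ i = s x * x $ i" for i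
  proof -
    have "x $ i = perturbed_root e x $ i / s x" by (subst x(2)[symmetric]) (simp add: f_def)
    then show ?thesis using s_pos[OF x(1)] by simp
  qed
  from that[OF x(1) this[unfolded s_def] pos[OF x(1)]] show thesis .
qed

text \<open>Components of points of the simplex are at most 1. The bound is uniform in
  \<open>x\<close> and \<open>e\<close>, and so controls the scaling factors while \<open>e\<close>
  tends to 0.\<close>

lemma perturbed_root_le:
  assumes "x \<in> prob_simplex" "0 \<le> e" "e \<le> 1"
  shows "perturbed_root e x $ i \<le> root (m - 1) (slice_sum m A i + 1)"
proof -
  have "slice_form m A x i \<le> slice_form m A (\<chi> j. 1) i"
  proof (rule slice_form_mono)
    show "0 \<le> x $ j" for j using assms(1) by (simp add: prob_simplex_def)
    show "x $ j \<le> (\<chi> j. 1) $ j" for j using prob_simplex_le_1[OF assms(1)] by simp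
  qed
  also have "\<dots> = slice_sum m A i" by (subst slice_form_const) simp
  finally have "slice_form m A x i + e \<le> slice_sum m A i + 1" using assms(3) by (rule add_mono)
  then show ?thesis
    unfolding perturbed_root_def vec_lambda_beta using order by (intro real_root_le_mono) auto
qed

end

section \<open>A positive eigenvector as a limit of perturbed solutions\<close>

context weakly_irreducible_tensor
begin

lemma positive_eigenvector:
  obtains x l where "\<And>i. 0 < x $ i" "0 \<le> l" "\<And>i. slice_form m A x i = l * (x $ i) ^ (m - 1)"
proof -
  define s where "s e x = (\<Sum>j\<in>UNIV. perturbed_root e x $ j)" for e x
  \<comment> \<open>Positive for \<open>perturbed_fixpoint\<close>, at most 1 for
    \<open>perturbed_root_le\<close>, and tending to 0.\<close>
  define e where "e k = 1 / real (Suc k)" for k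
  have e: "0 < e k" "e k \<le> 1" for k by (auto simp: e_def)
  have "\<forall>k. \<exists>x. x \<in> prob_simplex \<and> (\<forall>i. perturbed_root (e k) x $ i = s (e k) x * x $ i) \<and>
      (\<forall>i. 0 < perturbed_root (e k) x $ i)"
    using perturbed_fixpoint[OF e(1)] unfolding s_def by metis
  then obtain X where X: "\<And>k. X k \<in> prob_simplex"
    "\<And>k i. perturbed_root (e k) (X k) $ i = s (e k) (X k) * X k $ i"
    "\<And>k i. 0 < perturbed_root (e k) (X k) $ i"
    by metis
  \<comment> \<open>Bounds the factors \<open>s (e k) (X k)\<close> for all \<open>k\<close>, so
    that one Harnack constant serves the whole sequence.\<close>
  define R where "R = (\<Sum>i\<in>UNIV. root (m - 1) (slice_sum m A i + 1))"
  have s_pos: "0 < s (e k) (X k)" for k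
    unfolding s_def using X(3) by (intro sum_pos) auto
  have s_le: "s (e k) (X k) \<le> R" for k
    unfolding s_def R_def using e[of k] by (intro sum_mono perturbed_root_le X) auto
  have R: "0 \<le> R" using s_pos[of 0] s_le[of 0] by simp
  obtain C where C: "C > 0"
    "\<And>x i j. (\<And>k. 0 < x $ k) \<Longrightarrow> (\<And>k. slice_form m A x k \<le> R ^ (m - 1) * (x $ k) ^ (m - 1)) \<Longrightarrow>
      x $ i \<le> C * x $ j"
    using harnack[of "R ^ (m - 1)"] R by auto
  have X_pos: "0 < X k $ i" for k i
    using X(2)[of k i] X(3)[of k i] s_pos[of k] by (simp add: zero_less_mult_iff)
  have form_pos: "0 < slice_form m A (X k) i + e k" for k i
    using e(1)[of k] slice_form_mono(1)[of i "X k" "X k"] less_imp_le[OF X_pos[of k]]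
    by (intro add_nonneg_pos) auto
  have X_eq: "slice_form m A (X k) i + e k = s (e k) (X k) ^ (m - 1) * (X k $ i) ^ (m - 1)" for k i
  proof -
    have "slice_form m A (X k) i + e k = perturbed_root (e k) (X k) $ i ^ (m - 1)"
      unfolding perturbed_root_def vec_lambda_beta
      using order form_pos[of k i] by (subst real_root_pow_pos2) auto
    then show ?thesis by (simp add: X(2) power_mult_distrib)
  qed
  \<comment> \<open>Dropping the positive \<open>e k\<close> leaves the inequality that
    \<open>harnack\<close> asks for, with \<open>L = R ^ (m - 1)\<close>.\<close>
  have X_form_le: "slice_form m A (X k) i \<le> R ^ (m - 1) * (X k $ i) ^ (m - 1)" for k i
  proof -
    have "slice_form m A (X k) i \<le> s (e k) (X k) ^ (m - 1) * (X k $ i) ^ (m - 1)"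
      using X_eq[of k i] e(1)[of k] by simp
    also have "\<dots> \<le> R ^ (m - 1) * (X k $ i) ^ (m - 1)"
      using s_pos[of k] s_le[of k] X_pos[of k i] by (intro mult_right_mono power_mono) auto
    finally show ?thesis .
  qed
  \<comment> \<open>The components sum to 1 and each is at most \<open>C\<close> times the
    \<open>j\<close>-th. This bound does not depend on \<open>k\<close> and survives in the
    limit.\<close>
  have X_lower: "1 / (real CARD('n) * C) \<le> X k $ j" for k j
  proof -
    have "1 = (\<Sum>i\<in>UNIV. X k $ i)" using X(1)[of k] by (simp add: prob_simplex_def)
    also have "\<dots> \<le> (\<Sum>i\<in>(UNIV :: 'n set). C * X k $ j)"
      by (intro sum_mono C(2) X_pos X_form_le)
    finally show ?thesis using C(1) by (simp add: field_simps)
  qed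
  obtain x r where r: "strict_mono r" "(X \<circ> r) \<longlonglongrightarrow> x"
    using compact_prob_simplex[unfolded compact_eq_seq_compact_metric seq_compact_def] X(1) by metis
  have lim_X: "(\<lambda>k. X (r k)) \<longlonglongrightarrow> x" using r(2) by (simp add: o_def)
  have "e \<longlonglongrightarrow> 0" unfolding e_def using LIMSEQ_Suc[OF lim_1_over_n] by simp
  then have lim_e: "(\<lambda>k. e (r k)) \<longlonglongrightarrow> 0"
    using LIMSEQ_subseq_LIMSEQ[OF _ r(1)] by (fastforce simp: o_def)
  have lim_s: "(\<lambda>k. s (e (r k)) (X (r k))) \<longlonglongrightarrow> s 0 x"
    unfolding s_def by (intro tendsto_sum tendsto_perturbed_root lim_X lim_e)
  show thesis
  proof
    have "1 / (real CARD('n) * C) \<le> x $ i" for i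
      by (rule tendsto_lowerbound[OF tendsto_vec_nth[OF lim_X]]) (auto simp: X_lower)
    moreover have "0 < 1 / (real CARD('n) * C)" using C(1) by simp
    ultimately show "0 < x $ i" for i by (meson less_le_trans)
    have "0 \<le> s 0 x"
      by (rule tendsto_lowerbound[OF lim_s]) (auto simp: less_imp_le[OF s_pos])
    \<comment> \<open>Undoing the root turns the limit factor \<open>s 0 x\<close> into the
      eigenvalue \<open>s 0 x ^ (m - 1)\<close>.\<close>
    then show "0 \<le> s 0 x ^ (m - 1)" by simp
    show "slice_form m A x i = s 0 x ^ (m - 1) * (x $ i) ^ (m - 1)" for i
    proof (rule LIMSEQ_unique)
      show "(\<lambda>k. slice_form m A (X (r k)) i + e (r k)) \<longlonglongrightarrow> slice_form m A x i"
        using tendsto_add[OF tendsto_slice_form[OF lim_X] lim_e] by simp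
      show "(\<lambda>k. slice_form m A (X (r k)) i + e (r k)) \<longlonglongrightarrow> s 0 x ^ (m - 1) * (x $ i) ^ (m - 1)"
        unfolding X_eq by (intro tendsto_mult tendsto_power lim_s tendsto_vec_nth lim_X)
    qed
  qed
qed

end

section \<open>The spectral radius from a positive eigenvector\<close>

context nonneg_tensor
begin

lemma norm_tensor_apply_le:
  "cmod (tensor_apply m (\<lambda>idx. complex_of_real (A idx)) y $ i) \<le> slice_form m A (\<chi> j. cmod (y $ j)) i"
proof -
  have norm_prod: "cmod (\<Prod>j\<leftarrow>js. y $ j) = (\<Prod>j\<leftarrow>js. cmod (y $ j))" for js
    by (induction js) (auto simp: norm_mult)
  have "cmod (tensor_apply m (\<lambda>idx. complex_of_real (A idx)) y $ i)
      \<le> (\<Sum>js\<in>tuples (m - 1). cmod (complex_of_real (A (i # js)) * (\<Prod>j\<leftarrow>js. y $ j)))"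
    unfolding tensor_apply_def vec_lambda_beta by (rule norm_sum)
  also have "\<dots> = slice_form m A (\<chi> j. cmod (y $ j)) i"
    unfolding slice_form_def
  proof (intro sum.cong refl)
    fix js :: "'n list" assume "js \<in> tuples (m - 1)"
    moreover have "($) (\<chi> j. cmod (y $ j)) = (\<lambda>j. cmod (y $ j))" by auto
    ultimately show "cmod (complex_of_real (A (i # js)) * (\<Prod>j\<leftarrow>js. y $ j))
        = A (i # js) * (\<Prod>j\<leftarrow>js. (\<chi> j. cmod (y $ j)) $ j)"
      by (simp only: norm_mult norm_prod norm_of_real abs_of_nonneg slice_nonneg)
  qed
  finally show ?thesis .
qed

text \<open>Read over the complex numbers, \<open>x\<close> exhibits \<open>l\<close> as an
  eigenvalue. For maximality, \<open>x\<close> is scaled until it just dominates the moduli of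
  another eigenvector; comparing the forms at an index of equality bounds the modulus of that
  eigenvalue.\<close>

lemma spectral_radius_eqI:
  assumes x: "\<And>i. 0 < x $ i" and "0 \<le> l"
    and ev: "\<And>i. slice_form m A x i = l * (x $ i) ^ (m - 1)"
  shows "tensor_spectral_radius m (\<lambda>idx. complex_of_real (A idx)) = l"
  unfolding tensor_spectral_radius_def
proof (rule Greatest_equality)
  define z where "z = (\<chi> i. complex_of_real (x $ i))"
  have prod: "(\<Prod>j\<leftarrow>js. z $ j) = complex_of_real (\<Prod>j\<leftarrow>js. x $ j)" for js
    by (induction js) (auto simp: z_def)
  have "tensor_apply m (\<lambda>idx. complex_of_real (A idx)) z $ i = complex_of_real (slice_form m A x i)" for i
    unfolding tensor_apply_def slice_form_def vec_lambda_beta prod by simp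
  then have "tensor_apply m (\<lambda>idx. complex_of_real (A idx)) z
      = (\<chi> i. complex_of_real l * (z $ i) ^ (m - 1))"
    by (simp add: vec_eq_iff ev z_def)
  moreover have "z \<noteq> 0"
    using less_imp_neq[OF x[of undefined]] by (auto simp: vec_eq_iff z_def)
  ultimately have "tensor_eigenvalue m (\<lambda>idx. complex_of_real (A idx)) (complex_of_real l)"
    unfolding tensor_eigenvalue_def by blast
  then show "\<exists>c. tensor_eigenvalue m (\<lambda>idx. complex_of_real (A idx)) c \<and> l = cmod c"
    using \<open>0 \<le> l\<close> by (intro exI[of _ "complex_of_real l"]) simp
next
  fix r assume "\<exists>c. tensor_eigenvalue m (\<lambda>idx. complex_of_real (A idx)) c \<and> r = cmod c"
  then obtain c y where r: "r = cmod c" and "y \<noteq> 0"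
    and y: "tensor_apply m (\<lambda>idx. complex_of_real (A idx)) y = (\<chi> i. c * (y $ i) ^ (m - 1))"
    unfolding tensor_eigenvalue_def by blast
  \<comment> \<open>The least scaling with \<open>cmod (y $ j) \<le> t * x $ j\<close> for all
    \<open>j\<close>; equality holds at the index \<open>i\<close> obtained below.\<close>
  define t where "t = Max (range (\<lambda>i. cmod (y $ i) / x $ i))"
  have t_ge: "cmod (y $ i) / x $ i \<le> t" for i unfolding t_def by (intro Max_ge) auto
  have "t \<in> range (\<lambda>i. cmod (y $ i) / x $ i)" unfolding t_def by (intro Max_in) auto
  then obtain i where i: "t = cmod (y $ i) / x $ i" by blast
  have le: "cmod (y $ j) \<le> t * x $ j" for j
    using t_ge[of j] x[of j] by (simp add: field_simps)
  obtain k where "y $ k \<noteq> 0" using \<open>y \<noteq> 0\<close> by (auto simp: vec_eq_iff)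
  then have "0 < cmod (y $ k) / x $ k" using x by simp
  with t_ge[of k] have "0 < t" by simp
  have yi: "cmod (y $ i) = t * x $ i" using i x[of i] by simp
  have "r * (t * x $ i) ^ (m - 1) = cmod (tensor_apply m (\<lambda>idx. complex_of_real (A idx)) y $ i)"
    by (simp add: y norm_mult norm_power yi r)
  also have "\<dots> \<le> slice_form m A (\<chi> j. cmod (y $ j)) i" by (rule norm_tensor_apply_le)
  also have "\<dots> \<le> slice_form m A (t *\<^sub>R x) i" by (rule slice_form_mono) (auto simp: le)
  also have "\<dots> = l * (t * x $ i) ^ (m - 1)"
    by (simp add: slice_form_scale ev power_mult_distrib)
  finally show "r \<le> l" using x[of i] \<open>0 < t\<close> by simp
qed

end

section \<open>Circuits and geometric means along them\<close>

lemma cas_mset_ends: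
  "pre_digraph.cas G u p v \<Longrightarrow>
    add_mset v (mset (map (tail G) p)) = add_mset u (mset (map (head G) p))"
proof (induction p arbitrary: u)
  case (Cons e p)
  \<comment> \<open>The head of \<open>e\<close> is the start of the remaining walk
    \<open>p\<close>, so the endpoints telescope.\<close>
  then show ?case by (auto simp: pre_digraph.cas.simps add_mset_commute)
qed (simp add: pre_digraph.cas.simps)

text \<open>A cycle repeats no arc, and there are only finitely many arcs. This gives
  \<open>Max\<close> and \<open>Min\<close> over the circuits their meaning.\<close>

lemma finite_circuits_tensor_digraph: "finite (circuits (tensor_digraph m (A :: 'n::finite list \<Rightarrow> 'a::zero)))"
proof -
  interpret wf_digraph "tensor_digraph m A" by (rule wf_digraph_tensor_digraph)
  have "circuits (tensor_digraph m A) \<subseteq> {p. set p \<subseteq> UNIV \<and> distinct p}"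
    by (auto simp: circuits_def cycle_conv)
  then show ?thesis by (rule finite_subset) (rule finite_subset_distinct, simp)
qed

text \<open>The functional digraph of \<open>f\<close> has a closed walk by the pigeonhole principle.\<close>

lemma circuit_following:
  fixes f :: "'n::finite \<Rightarrow> 'n"
  assumes f: "\<And>i. (i, f i) \<in> arcs (tensor_digraph m A)"
  obtains \<gamma> where "\<gamma> \<in> circuits (tensor_digraph m A)" "\<gamma> \<noteq> []"
    "\<And>e. e \<in> set \<gamma> \<Longrightarrow> snd e = f (fst e)" "mset (map fst \<gamma>) = mset (map snd \<gamma>)"
proof -
  let ?G = "tensor_digraph m A"
  \<comment> \<open>The only arcs of \<open>H\<close> are the \<open>(i, f i)\<close>, so every
    cycle in it follows \<open>f\<close>.\<close>
  define H where "H = with_proj \<lparr>pverts = UNIV, parcs = range (\<lambda>i. (i, f i))\<rparr>"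
  interpret G: wf_digraph ?G by (rule wf_digraph_tensor_digraph)
  interpret H: wf_digraph H by unfold_locales (auto simp: H_def)
  have walk: "(i, (f ^^ Suc k) i) \<in> (arcs_ends H)\<^sup>+" for i k
    by (induction k) (auto simp: H_def intro: trancl_into_trancl)
  have "\<not> inj (\<lambda>k. (f ^^ k) undefined)"
    using finite_imageD[of "\<lambda>k. (f ^^ k) undefined" UNIV] by auto
  then obtain a b where "a < b" "(f ^^ a) undefined = (f ^^ b) undefined"
    unfolding inj_def by (metis nat_neq_iff)
  moreover define i where "i = (f ^^ a) undefined"
  \<comment> \<open>The number of steps \<open>b - a\<close> is positive; it is written as a
    successor because \<open>walk\<close> covers nonempty walks only.\<close>
  moreover have "(f ^^ b) undefined = (f ^^ Suc (b - a - 1)) i"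
  proof -
    have "Suc (b - a - 1) + a = b" using \<open>a < b\<close> by simp
    then show ?thesis unfolding i_def by (metis comp_apply funpow_add)
  qed
  ultimately have "(i, i) \<in> (arcs_ends H)\<^sup>+" using walk[of i "b - a - 1"] by simp
  then obtain p where "H.awalk i p i" "p \<noteq> []"
    unfolding H.reachable1_awalk by blast
  then have "H.closed_w p" by (auto simp: H.closed_w_def)
  then obtain \<gamma> where \<gamma>: "H.cycle \<gamma>" using H.closed_w_imp_cycle by blast
  have "subgraph H ?G"
    using f G.wf_digraph_axioms H.wf_digraph_axioms
    by (auto simp: subgraph_def H_def compatible_def)
  then have cyc: "G.cycle \<gamma>" using \<gamma> by (rule G.subgraph_cycle)
  obtain u where u: "H.awalk u \<gamma> u" using \<gamma> by (auto simp: H.cycle_def)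
  then have arcs: "set \<gamma> \<subseteq> arcs H" and cas: "H.cas u \<gamma> u" by (auto simp: H.awalk_def)
  show thesis
  proof
    show "\<gamma> \<in> circuits ?G" using cyc by (simp add: circuits_def)
    show "\<gamma> \<noteq> []" using \<gamma> by (auto simp: H.cycle_def)
    show "snd e = f (fst e)" if "e \<in> set \<gamma>" for e
      using arcs that by (auto simp: H_def)
    \<comment> \<open>The walk is closed, so the two end vertices in \<open>cas_mset_ends\<close>
      coincide and cancel.\<close>
    show "mset (map fst \<gamma>) = mset (map snd \<gamma>)"
      using cas_mset_ends[OF cas] by (simp add: H_def)
  qed
qed

text \<open>Multiplied around the closed walk \<open>\<gamma>\<close>, the weights \<open>w\<close> cancel.\<close>

lemma circuit_mean_bounds:
  fixes w K :: "'n \<Rightarrow> real"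
  assumes "\<gamma> \<noteq> []" and closed: "mset (map fst \<gamma>) = mset (map snd \<gamma>)"
    and w: "\<And>i. 0 < w i" and K: "\<And>i. 0 \<le> K i" and l: "0 \<le> l"
  shows circuit_mean_ge: "(\<And>e. e \<in> set \<gamma> \<Longrightarrow> l * w (fst e) \<le> K (fst e) * w (snd e)) \<Longrightarrow> l \<le> circuit_mean K \<gamma>"
    and circuit_mean_le: "(\<And>e. e \<in> set \<gamma> \<Longrightarrow> K (fst e) * w (snd e) \<le> l * w (fst e)) \<Longrightarrow> circuit_mean K \<gamma> \<le> l"
proof -
  define P where "P = (\<Prod>e\<leftarrow>\<gamma>. w (fst e))"
  have "P = prod_mset (image_mset w (mset (map fst \<gamma>)))"
    by (simp add: P_def prod_mset_prod_list[symmetric] image_mset.compositionality comp_def)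
  also have "\<dots> = (\<Prod>e\<leftarrow>\<gamma>. w (snd e))"
    unfolding closed by (simp add: prod_mset_prod_list[symmetric] image_mset.compositionality comp_def)
  finally have P_snd: "(\<Prod>e\<leftarrow>\<gamma>. w (snd e)) = P" ..
  have P: "0 < P" unfolding P_def by (rule prod_list_pos) (rule w)
  have eqs: "(\<Prod>e\<leftarrow>\<gamma>. l * w (fst e)) = l ^ length \<gamma> * P"
    "(\<Prod>e\<leftarrow>\<gamma>. K (fst e) * w (snd e)) = (\<Prod>e\<leftarrow>\<gamma>. K (fst e)) * P"
    by (simp_all add: prod_list_map_mult prod_list_map_const P_snd) (simp add: P_def)
  have len: "0 < length \<gamma>" using assms(1) by simp
  \<comment> \<open>At \<open>l = 0\<close> both sides vanish because \<open>\<gamma>\<close> is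
    nonempty; \<open>powr_realpow\<close> covers \<open>l > 0\<close>.\<close>
  have root: "(l ^ length \<gamma>) powr (1 / real (length \<gamma>)) = l"
    using l len by (cases "l = 0") (auto simp: powr_realpow[symmetric] powr_powr)
  show "l \<le> circuit_mean K \<gamma>" if "\<And>e. e \<in> set \<gamma> \<Longrightarrow> l * w (fst e) \<le> K (fst e) * w (snd e)"
  proof -
    have "l ^ length \<gamma> * P \<le> (\<Prod>e\<leftarrow>\<gamma>. K (fst e)) * P"
      unfolding eqs[symmetric] using that l w
      by (intro prod_list_mono_nonneg) (auto intro!: mult_nonneg_nonneg less_imp_le[OF w])
    then have "l ^ length \<gamma> \<le> (\<Prod>e\<leftarrow>\<gamma>. K (fst e))" using P by simp
    then have "(l ^ length \<gamma>) powr (1 / real (length \<gamma>)) \<le> circuit_mean K \<gamma>"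
      unfolding circuit_mean_def using l by (intro powr_mono2) auto
    then show ?thesis by (simp add: root)
  qed
  show "circuit_mean K \<gamma> \<le> l" if "\<And>e. e \<in> set \<gamma> \<Longrightarrow> K (fst e) * w (snd e) \<le> l * w (fst e)"
  proof -
    have "(\<Prod>e\<leftarrow>\<gamma>. K (fst e)) * P \<le> l ^ length \<gamma> * P"
      unfolding eqs[symmetric] using that K w
      by (intro prod_list_mono_nonneg) (auto intro!: mult_nonneg_nonneg less_imp_le[OF w])
    then have "(\<Prod>e\<leftarrow>\<gamma>. K (fst e)) \<le> l ^ length \<gamma>" using P by simp
    moreover have "0 \<le> (\<Prod>e\<leftarrow>\<gamma>. K (fst e))"
      using prod_list_mono_nonneg(1)[of \<gamma> "\<lambda>e. K (fst e)" "\<lambda>e. K (fst e)"] K by simp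
    ultimately have "circuit_mean K \<gamma> \<le> (l ^ length \<gamma>) powr (1 / real (length \<gamma>))"
      unfolding circuit_mean_def by (intro powr_mono2) auto
    then show ?thesis by (simp add: root)
  qed
qed

text \<open>With several vertices, a path from \<open>i\<close> to another vertex begins with an
  arc. With a single vertex reachability is trivial, and a nonzero entry gives the loop: it has a
  second index because \<open>m \<ge> 2\<close>.\<close>

lemma (in weakly_irreducible_tensor) out_arc:
  assumes "CARD('n) = 1 \<Longrightarrow> \<exists>idx\<in>tuples m. A idx \<noteq> 0"
  shows "\<exists>j. (i, j) \<in> E"
proof (cases "CARD('n) = 1")
  case True
  then obtain idx where idx: "idx \<in> tuples m" "A idx \<noteq> 0" using assms by blast
  then obtain k js where "idx = k # js" "length js = m - 1"
    using order by (cases idx) (auto simp: tuples_def)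
  moreover have "k = i" using True by (metis UNIV_I card_1_singletonE singletonD)
  moreover obtain j where "j \<in> set js" using \<open>length js = m - 1\<close> order by (cases js) auto
  ultimately show ?thesis using idx by (auto simp: arcs_tensor_digraph tuples_def)
next
  case False
  have "UNIV \<noteq> {i}"
  proof
    assume "UNIV = {i}"
    then have "CARD('n) = card {i}" by (rule arg_cong)
    with False show False by simp
  qed
  then obtain v where "v \<noteq> i" by blast
  moreover have "(i, v) \<in> E\<^sup>*" using wf_digraph.reachable_conv[OF wf_digraph_tensor_digraph, of m A i v] reach[of i v] by simp
  ultimately show ?thesis by (metis converse_rtranclE)
qed

section \<open>Comparison of the eigenvalue with circuit means\<close>

theorem theorem3p1:
  fixes m :: nat and A :: "'n::finite list \<Rightarrow> real"
  assumes order: "m \<ge> 2"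
    and nonneg: "\<And>idx. idx \<in> tuples m \<Longrightarrow> A idx \<ge> 0"
    and wirr: "weakly_irreducible m A"
    and nondegenerate: "CARD('n) = 1 \<Longrightarrow> \<exists>idx\<in>tuples m. A idx \<noteq> 0"
  shows "(MIN \<gamma>\<in>circuits (tensor_digraph m A). circuit_mean (slice_sum m A) \<gamma>)
           \<le> tensor_spectral_radius m (\<lambda>idx. complex_of_real (A idx))
       \<and> tensor_spectral_radius m (\<lambda>idx. complex_of_real (A idx))
           \<le> (MAX \<gamma>\<in>circuits (tensor_digraph m A). circuit_mean (slice_sum m A) \<gamma>)"
proof -
  interpret weakly_irreducible_tensor m A
    by unfold_locales (fact order, fact nonneg, fact wirr)
  obtain x l where x: "\<And>i. 0 < x $ i" and l: "0 \<le> l"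
    and ev: "\<And>i. slice_form m A x i = l * (x $ i) ^ (m - 1)"
    by (rule positive_eigenvector) blast
  have rho: "tensor_spectral_radius m (\<lambda>idx. complex_of_real (A idx)) = l"
    by (rule spectral_radius_eqI[OF x l ev])
  define N where "N i = {j. (i, j) \<in> E}" for i
  have N: "N i \<noteq> {}" for i using out_arc[OF nondegenerate] by (auto simp: N_def)
  have w: "0 < (x $ i) ^ (m - 1)" for i using x by simp

  have "\<exists>j\<in>N i. \<forall>k\<in>N i. x $ k \<le> x $ j" for i
    using Max_in[of "($) x ` N i"] Max_ge[of "($) x ` N i"] N[of i]
    by (auto simp: image_iff) (metis Max_ge finite finite_imageI imageI)
  then obtain f where f: "\<And>i. f i \<in> N i" "\<And>i k. k \<in> N i \<Longrightarrow> x $ k \<le> x $ f i" by metis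
  obtain \<gamma> where \<gamma>: "\<gamma> \<in> circuits (tensor_digraph m A)" "\<gamma> \<noteq> []"
    "\<And>e. e \<in> set \<gamma> \<Longrightarrow> snd e = f (fst e)" "mset (map fst \<gamma>) = mset (map snd \<gamma>)"
    using circuit_following[of f m A] f(1) by (auto simp: N_def)
  \<comment> \<open>Only out-neighbours of \<open>i\<close> enter the form at \<open>i\<close>, so
    all its variables may be raised to the largest one, \<open>x $ f i\<close>.\<close>
  have "l * (x $ i) ^ (m - 1) \<le> slice_sum m A i * (x $ f i) ^ (m - 1)" for i
  proof -
    have "slice_form m A x i \<le> slice_form m A (\<chi> j. x $ f i) i"
      using f(2) by (intro slice_form_mono) (auto simp: N_def less_imp_le[OF x])
    then show ?thesis by (simp add: ev slice_form_const)
  qed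
  then have "l \<le> circuit_mean (slice_sum m A) \<gamma>"
    by (intro circuit_mean_ge[OF \<gamma>(2,4), of "\<lambda>i. (x $ i) ^ (m - 1)"] w slice_sum_nonneg l)
       (simp add: \<gamma>(3))
  also have "\<dots> \<le> (MAX \<gamma>\<in>circuits (tensor_digraph m A). circuit_mean (slice_sum m A) \<gamma>)"
    using \<gamma>(1) by (intro Max_ge) (auto intro: finite_circuits_tensor_digraph)
  finally have upper: "l \<le> (MAX \<gamma>\<in>circuits (tensor_digraph m A). circuit_mean (slice_sum m A) \<gamma>)" .

  have "\<exists>j\<in>N i. \<forall>k\<in>N i. x $ j \<le> x $ k" for i
    using Min_in[of "($) x ` N i"] Min_le[of "($) x ` N i"] N[of i]
    by (auto simp: image_iff) (metis Min_le finite finite_imageI imageI)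
  then obtain g where g: "\<And>i. g i \<in> N i" "\<And>i k. k \<in> N i \<Longrightarrow> x $ g i \<le> x $ k" by metis
  obtain \<delta> where \<delta>: "\<delta> \<in> circuits (tensor_digraph m A)" "\<delta> \<noteq> []"
    "\<And>e. e \<in> set \<delta> \<Longrightarrow> snd e = g (fst e)" "mset (map fst \<delta>) = mset (map snd \<delta>)"
    using circuit_following[of g m A] g(1) by (auto simp: N_def)
  \<comment> \<open>Dually, lowering these variables to the smallest one, \<open>x $ g i\<close>,
    does not increase the form.\<close>
  have "slice_sum m A i * (x $ g i) ^ (m - 1) \<le> l * (x $ i) ^ (m - 1)" for i
  proof -
    have "slice_form m A (\<chi> j. x $ g i) i \<le> slice_form m A x i"
      using g(2) by (intro slice_form_mono) (auto simp: N_def less_imp_le[OF x])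
    then show ?thesis by (simp add: ev slice_form_const)
  qed
  then have "circuit_mean (slice_sum m A) \<delta> \<le> l"
    by (intro circuit_mean_le[OF \<delta>(2,4), of "\<lambda>i. (x $ i) ^ (m - 1)"] w slice_sum_nonneg l)
       (simp add: \<delta>(3))
  moreover have "(MIN \<gamma>\<in>circuits (tensor_digraph m A). circuit_mean (slice_sum m A) \<gamma>)
      \<le> circuit_mean (slice_sum m A) \<delta>"
    using \<delta>(1) by (intro Min_le) (auto intro: finite_circuits_tensor_digraph)
  ultimately show ?thesis using upper rho by simp
qed

end
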